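(* Let $n \ge 1$ be an integer. Every configuration of the game of size $n$ has a solution if and only if the number of coverings of the triangular board of size $n$ by $1\times 1$ and $2\times 1$ pieces is odd.
   Context: For an integer $n\ge 1$, the (triangular Lights Out) game of size $n$ is played on a triangular arrangement of $\beta = n(n+1)/2$ circles ("buttons") with side length $n$: row $r$ ($1\le r\le n$, from top to bottom) contains $r$ buttons, and circles touch as in the usual triangular packing. In coordinates, the buttons are the pairs $(r,s)$ with $1\le s\le r\le n$, and the neighbors of $(r,s)$ (the circles tangent to it) are those among $(r,s-1),(r,s+1),(r-1,s-1),(r-1,s),(r+1,s),(r+1,s+1)$ that belong to the arrangement. Each button is either lit or unlit; a configuration is identified with the set $C$ of lit buttons. Pressing a button switches the state of that button and of all of its neighbors. Since the order of presses is irrelevant and pressing a button twice has no effect, a move is described by a set $X$ of buttons, each pressed once; $C \xrightarrow{X} D$ means that pressing the buttons of $X$ starting from configuration $C$ yields configuration $D$. A set of buttons $X$ is a solution for a configuration $C$ if $C \xrightarrow{X} \emptyset$, i.e. pressing the buttons in $X$ starting from $C$ turns all buttons off. A covering of the board by $1\times 1$ and $2\times 1$ pieces is a partition of the set of buttons into subsets having one or two elements, in which every two-element subset consists of two neighboring buttons. *)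

theory Defs
  imports Main "HOL-Library.Disjoint_Sets"
begin

type_synonym button = "nat \<times> nat"

definition buttons :: "nat \<Rightarrow> button set" where
  "buttons n = {(r, s). 1 \<le> s \<and> s \<le> r \<and> r \<le> n}"

text \<open>
  Truncated subtraction is harmless here: coordinates of buttons are positive, and no pair
  with a coordinate equal to 0 is a button.
\<close>

definition neighbors :: "nat \<Rightarrow> button \<Rightarrow> button set" where
  "neighbors n = (\<lambda>(r, s).
     {(r, s - 1), (r, s + 1), (r - 1, s - 1), (r - 1, s), (r + 1, s), (r + 1, s + 1)}
       \<inter> buttons n)"

definition press :: "nat \<Rightarrow> button \<Rightarrow> button set \<Rightarrow> button set" where
  "press n b C = sym_diff C (insert b (neighbors n b))"

text \<open>Presses commute, so the fold over a finite set of buttons below is well defined.\<close>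

lemma comp_fun_commute_press: "comp_fun_commute (press n)"
  by standard (auto simp: press_def fun_eq_iff)

definition moves_to :: "nat \<Rightarrow> button set \<Rightarrow> button set \<Rightarrow> button set \<Rightarrow> bool" where
  "moves_to n C X D \<longleftrightarrow> Finite_Set.fold (press n) C X = D"

definition is_solution :: "nat \<Rightarrow> button set \<Rightarrow> button set \<Rightarrow> bool" where
  "is_solution n C X \<longleftrightarrow> X \<subseteq> buttons n \<and> moves_to n C X {}"

definition coverings :: "nat \<Rightarrow> button set set set" where
  "coverings n = {P. partition_on (buttons n) P \<and>
     (\<forall>T\<in>P. (card T = 1 \<or> card T = 2) \<and>
            (card T = 2 \<longrightarrow> (\<exists>a b. T = {a, b} \<and> b \<in> neighbors n a)))}"

lemma finite_buttons: "finite (buttons n)"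
  by (rule finite_subset[of _ "{..n} \<times> {..n}"]) (auto simp: buttons_def)

text \<open>Hence \<^term>\<open>card (coverings n)\<close> is the actual number of coverings.\<close>

lemma finite_coverings: "finite (coverings n)"
  by (rule finite_subset[of _ "Pow (Pow (buttons n))"])
    (auto simp: coverings_def partition_on_def finite_buttons)

end

theory Submission
  imports Defs "HOL-Library.Z2" "Jordan_Normal_Form.Determinant"
begin

text \<open>
  Over the field with two elements, let \<open>A\<close> be the identity plus the adjacency matrix of the
  board. Pressing a set of buttons adds \<open>A x\<close> to the configuration, so every configuration is
  solvable iff \<open>A\<close> has trivial kernel iff \<open>det A \<noteq> 0\<close>. Signs do not matter modulo 2, so the
  Leibniz formula turns \<open>det A\<close> into the parity of the number of permutations that send each
  button to itself or to a neighbour. Inverting such permutations pairs off those that are not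
  involutions, and the involutions are exactly the coverings.
\<close>

section \<open>Linear algebra modulo 2\<close>

lemma of_nat_bit: "(of_nat n :: bit) = of_bool (odd n)"
  by (cases "of_nat n :: bit") (simp_all flip: even_of_nat_iff[where 'a = bit])

text \<open>A vector over \<open>bit\<close> is determined by its support, with indicator vectors as
  the inverse. This is the dictionary between button sets and vectors.\<close>

lemma bij_betw_bit_vec_subsets:
  "bij_betw (\<lambda>v. {i \<in> {0..<m}. v $ i = (1::bit)}) (carrier_vec m) (Pow {0..<m})"
proof (rule bij_betw_byWitness[where f' = "\<lambda>X. vec m (\<lambda>i. of_bool (i \<in> X))"])
  show "\<forall>v\<in>carrier_vec m. vec m (\<lambda>i. of_bool (i \<in> {i \<in> {0..<m}. v $ i = (1::bit)})) = v"
  proof (intro ballI eq_vecI)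
    fix v :: "bit vec" and i
    assume "v \<in> carrier_vec m" "i < dim_vec v"
    then show "vec m (\<lambda>i. of_bool (i \<in> {i \<in> {0..<m}. v $ i = (1::bit)})) $ i = v $ i"
      by (cases "v $ i") auto
  qed auto
next
  show "\<forall>X\<in>Pow {0..<m}. {i \<in> {0..<m}. vec m (\<lambda>i. of_bool (i \<in> X)) $ i = (1::bit)} = X"
    by (auto simp: of_bool_def split: if_splits)
next
  show "(\<lambda>v. {i \<in> {0..<m}. v $ i = (1::bit)}) ` carrier_vec m \<subseteq> Pow {0..<m}"
    by blast
next
  show "(\<lambda>X. vec m (\<lambda>i. of_bool (i \<in> X) :: bit)) ` Pow {0..<m} \<subseteq> carrier_vec m"
    by (intro image_subsetI) (rule vec_carrier)
qed

text \<open>Under symmetric difference \<open>Pow V\<close> is a finite group and \<open>T\<close>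
  an endomorphism of it. Counting makes surjectivity equivalent to injectivity, and for a
  homomorphism injectivity means a trivial kernel.\<close>

lemma sym_diff_kernel_iff_surj:
  assumes fin: "finite V" and maps: "\<And>X. X \<subseteq> V \<Longrightarrow> T X \<subseteq> V"
    and add: "\<And>X Y. X \<subseteq> V \<Longrightarrow> Y \<subseteq> V \<Longrightarrow> T (sym_diff X Y) = sym_diff (T X) (T Y)"
  shows "(\<forall>C\<subseteq>V. \<exists>X\<subseteq>V. T X = C) \<longleftrightarrow> (\<forall>X\<subseteq>V. T X = {} \<longrightarrow> X = {})"
proof -
  have emp: "T {} = {}" using add[of "{}" "{}"] by auto
  have fP: "finite (Pow V)" using fin by simp
  have im: "T ` Pow V \<subseteq> Pow V" using maps by auto
  have "(\<forall>C\<subseteq>V. \<exists>X\<subseteq>V. T X = C) \<longleftrightarrow> T ` Pow V = Pow V"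
  proof
    assume "\<forall>C\<subseteq>V. \<exists>X\<subseteq>V. T X = C"
    then show "T ` Pow V = Pow V" using im by blast
  next
    assume "T ` Pow V = Pow V"
    then show "\<forall>C\<subseteq>V. \<exists>X\<subseteq>V. T X = C" by (metis Pow_iff imageE)
  qed
  also have "\<dots> \<longleftrightarrow> inj_on T (Pow V)"
  proof
    assume "T ` Pow V = Pow V"
    then have "card (T ` Pow V) = card (Pow V)" by (rule arg_cong)
    then show "inj_on T (Pow V)" by (rule eq_card_imp_inj_on[OF fP])
  qed (rule endo_inj_surj[OF fP im])
  also have "\<dots> \<longleftrightarrow> (\<forall>X\<subseteq>V. T X = {} \<longrightarrow> X = {})"
  proof
    assume "inj_on T (Pow V)"
    then show "\<forall>X\<subseteq>V. T X = {} \<longrightarrow> X = {}"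
      using emp by (auto simp: inj_on_def)
  next
    assume ker: "\<forall>X\<subseteq>V. T X = {} \<longrightarrow> X = {}"
    show "inj_on T (Pow V)"
    proof (rule inj_onI)
      fix X Y assume "X \<in> Pow V" "Y \<in> Pow V" "T X = T Y"
      then have "sym_diff X Y \<subseteq> V" "T (sym_diff X Y) = {}" using add[of X Y] by auto
      then have "sym_diff X Y = {}" using ker by blast
      then show "X = Y" by blast
    qed
  qed
  finally show ?thesis .
qed

lemma odd_card_sym_diff:
  assumes "finite A" "finite B"
  shows "odd (card (sym_diff A B)) \<longleftrightarrow> odd (card A) \<noteq> odd (card B)"
proof -
  have "card (sym_diff A B) = card (A - B) + card (B - A)"
    using assms by (intro card_Un_disjoint) auto
  moreover have "card A = card (A - B) + card (A \<inter> B)" "card B = card (B - A) + card (A \<inter> B)"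
    using assms by (metis card_Diff_subset_Int card_Int_Diff Int_commute add.commute finite_Int)+
  ultimately show ?thesis by auto
qed

text \<open>In terms of sets, this is the product modulo 2 of the 0-1 matrix of \<open>R\<close>
  (row \<open>v\<close>, column \<open>x\<close>) with the indicator vector of
  \<open>X\<close>.\<close>

definition toggled :: "'a set \<Rightarrow> ('a \<Rightarrow> 'a \<Rightarrow> bool) \<Rightarrow> 'a set \<Rightarrow> 'a set" where
  "toggled V R X = {v \<in> V. odd (card {x \<in> X. R v x})}"

lemma toggled_sym_diff:
  assumes "finite X" "finite Y"
  shows "toggled V R (sym_diff X Y) = sym_diff (toggled V R X) (toggled V R Y)"
proof -
  have "{x \<in> sym_diff X Y. R v x} = sym_diff {x \<in> X. R v x} {x \<in> Y. R v x}" for v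
    by auto
  then show ?thesis
    using assms by (auto simp: toggled_def odd_card_sym_diff)
qed

lemma toggled_surj_iff_odd_permutations_nat:
  fixes R :: "nat \<Rightarrow> nat \<Rightarrow> bool"
  shows "(\<forall>C\<subseteq>{0..<m}. \<exists>X\<subseteq>{0..<m}. toggled {0..<m} R X = C) \<longleftrightarrow>
    odd (card {p. p permutes {0..<m} \<and> (\<forall>i\<in>{0..<m}. R i (p i))})"
proof -
  define A :: "bit mat" where "A = mat m m (\<lambda>(i, j). of_bool (R i j))"
  have A: "A \<in> carrier_mat m m" by (simp add: A_def)
  define S where "S v = {i \<in> {0..<m}. v $ i = 1}" for v :: "bit vec"
  have bij: "bij_betw S (carrier_vec m) (Pow {0..<m})"
    using bij_betw_bit_vec_subsets by (simp add: S_def[abs_def])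
  have S_0_iff: "S v = {} \<longleftrightarrow> v = 0\<^sub>v m" if "v \<in> carrier_vec m" for v
  proof -
    have "S (0\<^sub>v m) = {}" by (auto simp: S_def)
    then show ?thesis using bij that unfolding bij_betw_def inj_on_def by (metis zero_carrier_vec)
  qed
  have S_mult: "S (A *\<^sub>v v) = toggled {0..<m} R (S v)" if "v \<in> carrier_vec m" for v
  proof -
    have "(A *\<^sub>v v) $ i = of_nat (card {x \<in> S v. R i x})" if i: "i < m" for i
    proof -
      have "(A *\<^sub>v v) $ i = (\<Sum>j\<in>{0..<m}. of_bool (R i j) * v $ j)"
        using i \<open>v \<in> carrier_vec m\<close> by (simp add: A_def scalar_prod_def)
      also have "\<dots> = (\<Sum>j\<in>{0..<m}. of_bool (j \<in> {x \<in> S v. R i x}))"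
      proof (rule sum.cong)
        fix j assume "j \<in> {0..<m}"
        then show "of_bool (R i j) * v $ j = of_bool (j \<in> {x \<in> S v. R i x})"
          by (cases "v $ j") (auto simp: S_def)
      qed simp
      also have "\<dots> = of_nat (card ({0..<m} \<inter> {x \<in> S v. R i x}))"
        by (simp add: sum_of_bool_eq Int_def)
      also have "{0..<m} \<inter> {x \<in> S v. R i x} = {x \<in> S v. R i x}"
        by (auto simp: S_def)
      finally show ?thesis .
    qed
    then show ?thesis
      using mult_mat_vec_carrier[OF A that] by (auto simp: S_def[of "A *\<^sub>v v"] toggled_def of_nat_bit)
  qed
  have "det A = (\<Sum>p | p permutes {0..<m}. of_bool (\<forall>i\<in>{0..<m}. R i (p i)))"
  proof -
    \<comment> \<open>In \<open>bit\<close> we have -1 = 1, so the sign disappears, and a product of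
      0-1 entries is 1 exactly when every entry is 1.\<close>
    have "signof p * (\<Prod>i = 0..<m. A $$ (i, p i)) = of_bool (\<forall>i\<in>{0..<m}. R i (p i))"
      if p: "p permutes {0..<m}" for p
    proof -
      have "(\<Prod>i = 0..<m. A $$ (i, p i)) = (\<Prod>i = 0..<m. of_bool (R i (p i)))"
        using permutes_in_image[OF p] by (intro prod.cong) (auto simp: A_def)
      also have "\<dots> = of_bool (\<forall>i\<in>{0..<m}. R i (p i))"
        by (auto simp: prod_zero_iff intro!: prod.neutral)
      finally show ?thesis by (simp add: sign_def)
    qed
    then show ?thesis unfolding det_def'[OF A] by (intro sum.cong) auto
  qed
  also have "\<dots> = of_nat (card {p. p permutes {0..<m} \<and> (\<forall>i\<in>{0..<m}. R i (p i))})"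
    by (simp add: sum_of_bool_eq finite_permutations Collect_conj_eq[symmetric])
  finally have det: "det A = 0 \<longleftrightarrow>
      even (card {p. p permutes {0..<m} \<and> (\<forall>i\<in>{0..<m}. R i (p i))})"
    by (simp add: of_nat_bit)
  \<comment> \<open>The determinant criterion \<open>det_0_iff_vec_prod_zero\<close> concerns kernel
    vectors, so surjectivity is first traded for a trivial kernel and then carried from sets to
    vectors along \<open>S\<close>.\<close>
  have "(\<forall>C\<subseteq>{0..<m}. \<exists>X\<subseteq>{0..<m}. toggled {0..<m} R X = C) \<longleftrightarrow>
      (\<forall>X\<subseteq>{0..<m}. toggled {0..<m} R X = {} \<longrightarrow> X = {})"
    by (intro sym_diff_kernel_iff_surj toggled_sym_diff) (auto simp: toggled_def intro: finite_subset)
  also have "\<dots> \<longleftrightarrow> (\<forall>X\<in>S ` carrier_vec m. toggled {0..<m} R X = {} \<longrightarrow> X = {})"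
    unfolding bij_betw_imp_surj_on[OF bij] Ball_def Pow_iff ..
  also have "\<dots> \<longleftrightarrow> (\<forall>v\<in>carrier_vec m. toggled {0..<m} R (S v) = {} \<longrightarrow> S v = {})"
    by (rule ball_simps)
  also have "\<dots> \<longleftrightarrow> (\<forall>v\<in>carrier_vec m. A *\<^sub>v v = 0\<^sub>v m \<longrightarrow> v = 0\<^sub>v m)"
    using S_0_iff S_mult mult_mat_vec_carrier[OF A] by metis
  also have "\<dots> \<longleftrightarrow> det A \<noteq> 0"
    unfolding det_0_iff_vec_prod_zero[OF A] by blast
  finally show ?thesis using det by simp
qed

text \<open>Both sides are invariant under relabelling, so an enumeration \<open>f\<close> of
  \<open>V\<close> reduces the claim to the index set \<open>{0..<m}\<close> of matrices.\<close>

lemma toggled_surj_iff_odd_permutations: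
  assumes fin: "finite V"
  shows "(\<forall>C\<subseteq>V. \<exists>X\<subseteq>V. toggled V R X = C) \<longleftrightarrow>
    odd (card {p. p permutes V \<and> (\<forall>v\<in>V. R v (p v))})"
proof -
  define m where "m = card V"
  obtain f where f: "bij_betw f {0..<m} V"
    using ex_bij_betw_nat_finite[OF fin] m_def by blast
  have inj: "inj_on f {0..<m}" and im: "f ` {0..<m} = V" using f by (auto simp: bij_betw_def)
  define Q where "Q = (\<lambda>i j. R (f i) (f j))"
  have tog: "toggled V R (f ` X) = f ` toggled {0..<m} Q X" if X: "X \<subseteq> {0..<m}" for X
  proof -
    have "card {x \<in> f ` X. R v x} = card {x \<in> X. R v (f x)}" for v
    proof -
      have "{x \<in> f ` X. R v x} = f ` {x \<in> X. R v (f x)}" by auto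
      moreover have "inj_on f {x \<in> X. R v (f x)}" using X by (blast intro: inj_on_subset[OF inj])
      ultimately show ?thesis by (simp add: card_image)
    qed
    then show ?thesis by (auto simp: toggled_def Q_def im[symmetric])
  qed
  have all_iff: "(\<forall>X\<subseteq>V. P X) \<longleftrightarrow> (\<forall>X\<subseteq>{0..<m}. P (f ` X))" for P
    unfolding im[symmetric] by (rule all_subset_image)
  have ex_iff: "(\<exists>X\<subseteq>V. P X) \<longleftrightarrow> (\<exists>X\<subseteq>{0..<m}. P (f ` X))" for P
    using all_iff[of "\<lambda>X. \<not> P X"] by blast
  have "(\<forall>C\<subseteq>V. \<exists>X\<subseteq>V. toggled V R X = C) \<longleftrightarrow>
      (\<forall>C\<subseteq>{0..<m}. \<exists>X\<subseteq>{0..<m}. toggled V R (f ` X) = f ` C)"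
    unfolding all_iff ex_iff ..
  also have "\<dots> \<longleftrightarrow> (\<forall>C\<subseteq>{0..<m}. \<exists>X\<subseteq>{0..<m}. toggled {0..<m} Q X = C)"
  proof -
    have "toggled V R (f ` X) = f ` C \<longleftrightarrow> toggled {0..<m} Q X = C"
      if "X \<subseteq> {0..<m}" "C \<subseteq> {0..<m}" for X C
      unfolding tog[OF that(1)] using that by (intro inj_on_image_eq_iff[OF inj]) (auto simp: toggled_def)
    then show ?thesis by metis
  qed
  also have "\<dots> \<longleftrightarrow> odd (card {p. p permutes {0..<m} \<and> (\<forall>i\<in>{0..<m}. Q i (p i))})"
    by (rule toggled_surj_iff_odd_permutations_nat)
  also have "card {p. p permutes {0..<m} \<and> (\<forall>i\<in>{0..<m}. Q i (p i))} =
      card {p. p permutes V \<and> (\<forall>v\<in>V. R v (p v))}"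
  proof -
    \<comment> \<open>Conjugation by \<open>f\<close>, extended by the identity outside
      \<open>V\<close>.\<close>
    let ?h = "\<lambda>p x. if x \<in> V then f (p (inv_into {0..<m} f x)) else x"
    have b: "bij_betw ?h {p. p permutes {0..<m}} {p. p permutes V}"
      using f by (rule bij_betw_permutations)
    have ok: "(\<forall>v\<in>V. R v (?h p v)) \<longleftrightarrow> (\<forall>i\<in>{0..<m}. Q i (p i))" for p
      by (auto simp: Q_def im[symmetric] inv_into_f_f[OF inj])
    have "bij_betw ?h {p \<in> {p. p permutes {0..<m}}. \<forall>i\<in>{0..<m}. Q i (p i)}
        {p \<in> {p. p permutes V}. \<forall>v\<in>V. R v (p v)}"
      by (rule bij_betw_Collect[OF b]) (rule ok)
    then show ?thesis by (simp add: bij_betw_same_card)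
  qed
  finally show ?thesis .
qed

section \<open>Involutions and coverings\<close>

text \<open>The orbits \<open>{x, g x}\<close> partition \<open>S\<close> into blocks of size
  two.\<close>

lemma even_card_fixpoint_free_involution:
  assumes fin: "finite S" and maps: "\<And>x. x \<in> S \<Longrightarrow> g x \<in> S"
    and inv: "\<And>x. x \<in> S \<Longrightarrow> g (g x) = x" and free: "\<And>x. x \<in> S \<Longrightarrow> g x \<noteq> x"
  shows "even (card S)"
proof -
  have U: "\<Union> ((\<lambda>x. {x, g x}) ` S) = S" using maps by auto
  have "2 dvd card (\<Union> ((\<lambda>x. {x, g x}) ` S))"
  proof (rule dvd_partition)
    show "\<forall>c\<in>(\<lambda>x. {x, g x}) ` S. 2 dvd card c" using free[symmetric] by auto
    show "\<forall>c1\<in>(\<lambda>x. {x, g x}) ` S. \<forall>c2\<in>(\<lambda>x. {x, g x}) ` S. c1 \<noteq> c2 \<longrightarrow> c1 \<inter> c2 = {}"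
      using inv by (auto, metis+)
    show "finite (\<Union> ((\<lambda>x. {x, g x}) ` S))" unfolding U by (rule fin)
  qed
  then show ?thesis by (simp add: U)
qed

text \<open>The points moved by \<open>g\<close> are closed under \<open>g\<close>, so the
  fixpoint-free case shows that they are even in number.\<close>

lemma even_card_involution_iff:
  assumes fin: "finite S" and maps: "\<And>x. x \<in> S \<Longrightarrow> g x \<in> S"
    and inv: "\<And>x. x \<in> S \<Longrightarrow> g (g x) = x"
  shows "even (card S) \<longleftrightarrow> even (card {x \<in> S. g x = x})"
proof -
  have "even (card {x \<in> S. g x \<noteq> x})"
    by (rule even_card_fixpoint_free_involution[of _ g]) (use assms in auto)
  moreover have "card S = card {x \<in> S. g x = x} + card {x \<in> S. g x \<noteq> x}"
    using fin by (subst card_Un_disjoint[symmetric]) (auto intro: arg_cong[where f = card])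
  ultimately show ?thesis by simp
qed

text \<open>Inversion is an involution on these permutations: symmetry of \<open>R\<close> preserves
  the constraint. Its fixed points are the permutations that are their own inverse.\<close>

lemma odd_permutations_iff_odd_involutions:
  assumes fin: "finite V" and sym: "\<And>x y. x \<in> V \<Longrightarrow> y \<in> V \<Longrightarrow> R x y \<Longrightarrow> R y x"
  shows "odd (card {p. p permutes V \<and> (\<forall>v\<in>V. R v (p v))}) \<longleftrightarrow>
    odd (card {p. p permutes V \<and> (\<forall>v\<in>V. R v (p v)) \<and> (\<forall>v\<in>V. p (p v) = v)})"
proof -
  let ?S = "{p. p permutes V \<and> (\<forall>v\<in>V. R v (p v))}"
  have "even (card ?S) \<longleftrightarrow> even (card {p \<in> ?S. Hilbert_Choice.inv p = p})"
  proof (rule even_card_involution_iff)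
    show "finite ?S" using finite_permutations[OF fin] by simp
    fix p assume p: "p \<in> ?S"
    then have pV: "p permutes V" by simp
    show "Hilbert_Choice.inv (Hilbert_Choice.inv p) = p" using inv_inv_eq permutes_bij[OF pV] by blast
    have "R v (Hilbert_Choice.inv p v)" if v: "v \<in> V" for v
    proof -
      have w: "Hilbert_Choice.inv p v \<in> V" using permutes_in_image[OF permutes_inv[OF pV]] v by blast
      then have "R (Hilbert_Choice.inv p v) v" using p permutes_inverses(1)[OF pV, of v] by force
      then show ?thesis using sym v w by blast
    qed
    then show "Hilbert_Choice.inv p \<in> ?S" using permutes_inv[OF pV] by blast
  qed
  also have "{p \<in> ?S. Hilbert_Choice.inv p = p} =
      {p. p permutes V \<and> (\<forall>v\<in>V. R v (p v)) \<and> (\<forall>v\<in>V. p (p v) = v)}"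
  proof -
    have "Hilbert_Choice.inv p = p \<longleftrightarrow> (\<forall>v\<in>V. p (p v) = v)" if p: "p permutes V" for p
    proof
      assume "Hilbert_Choice.inv p = p" then show "\<forall>v\<in>V. p (p v) = v" using permutes_inverses(2)[OF p] by simp
    next
      assume "\<forall>v\<in>V. p (p v) = v"
      then have "p (p v) = v" for v using p by (cases "v \<in> V") (auto simp: permutes_def)
      then show "Hilbert_Choice.inv p = p" by (intro inv_unique_comp) (auto simp: fun_eq_iff)
    qed
    then show ?thesis by auto
  qed
  finally show ?thesis by simp
qed

text \<open>An involution corresponds to its partition into orbits: fixed points give singletons and
  2-cycles give pairs. Asking for both \<open>E a b\<close> and \<open>E b a\<close> lets an
  unordered block be read in either order.\<close>

lemma bij_betw_involutions_partitions:
  "bij_betw (\<lambda>p. (\<lambda>v. {v, p v}) ` V)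
     {p. p permutes V \<and> (\<forall>v\<in>V. p v = v \<or> E v (p v)) \<and> (\<forall>v\<in>V. p (p v) = v)}
     {P. partition_on V P \<and> (\<forall>T\<in>P. (card T = 1 \<or> card T = 2) \<and>
        (card T = 2 \<longrightarrow> (\<exists>a b. T = {a, b} \<and> E a b \<and> E b a)))}"
  (is "bij_betw ?h ?I ?P")
  if sym: "\<And>a b. a \<in> V \<Longrightarrow> b \<in> V \<Longrightarrow> E a b \<Longrightarrow> E b a"
proof (rule bij_betw_imageI)
  show "inj_on ?h ?I"
  proof (rule inj_onI)
    fix p q assume p: "p \<in> ?I" and q: "q \<in> ?I" and eq: "?h p = ?h q"
    have "p v = q v" if v: "v \<in> V" for v
    proof -
      have "{v, p v} \<in> ?h q" using v eq by blast
      then obtain w where "w \<in> V" "{v, p v} = {w, q w}" by blast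
      \<comment> \<open>Either \<open>w = v\<close> and the partners agree, or
        \<open>v = q w\<close> and \<open>p v = w\<close>, in which case
        \<open>q v = q (q w) = w = p v\<close>.\<close>
      then show ?thesis using q by (auto simp: doubleton_eq_iff)
    qed
    moreover have "p v = q v" if "v \<notin> V" for v
      using p q that by (simp add: permutes_def)
    ultimately show "p = q" by blast
  qed
  show "?h ` ?I = ?P"
  proof (intro equalityI subsetI)
    fix P assume "P \<in> ?h ` ?I"
    then obtain p where p: "p \<in> ?I" and P: "P = ?h p" by blast
    have pV: "p v \<in> V" if "v \<in> V" for v using p that by (simp add: permutes_in_image)
    have "partition_on V P"
      unfolding P using p pV permutes_inj[of p V] by (intro partition_onI) (auto simp: disjnt_def dest: injD)
    moreover have "(card {v, p v} = 1 \<or> card {v, p v} = 2) \<and>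
        (card {v, p v} = 2 \<longrightarrow> (\<exists>a b. {v, p v} = {a, b} \<and> E a b \<and> E b a))" if v: "v \<in> V" for v
    proof (cases "p v = v")
      case False
      then have "E v (p v)" using p v by blast
      then show ?thesis using sym[OF v pV[OF v]] False by auto
    qed simp
    ultimately show "P \<in> ?P" unfolding P by blast
  next
    fix P assume P: "P \<in> ?P"
    then have part: "partition_on V P" by simp
    have block_eq: "T = T'" if "T \<in> P" "T' \<in> P" "v \<in> T" "v \<in> T'" for T T' v
      using that partition_onD2[OF part] by (auto dest: disjointD)
    \<comment> \<open>A singleton block is covered by \<open>w = v\<close>. Disjointness of the
      blocks makes the partner unique.\<close>
    have ex1: "\<exists>!w. {v, w} \<in> P" if v: "v \<in> V" for v
    proof -
      obtain T where T: "T \<in> P" "v \<in> T" using part v by (auto simp: partition_on_def)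
      then have "card T = 1 \<or> card T = 2" using P by blast
      then obtain w where w: "T = {v, w}" using T(2) by (auto simp: card_1_singleton_iff card_2_iff)
      have "w' = w" if "{v, w'} \<in> P" for w'
      proof -
        have "{v, w'} = {v, w}"
          using block_eq[of _ T v] that T w by blast
        then show ?thesis by (auto simp: doubleton_eq_iff)
      qed
      then show ?thesis using T(1) w by blast
    qed
    \<comment> \<open>The inverse construction swaps the two elements of each pair and fixes
      singletons. The identity outside \<open>V\<close> is what \<open>permutes\<close>
      demands.\<close>
    define p where "p = (\<lambda>v. if v \<in> V then THE w. {v, w} \<in> P else v)"
    have pP: "{v, p v} \<in> P" if "v \<in> V" for v
      using theI'[OF ex1[OF that]] that by (simp add: p_def)
    have p_eq: "p v = w" if "v \<in> V" "{v, w} \<in> P" for v w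
      using ex1 pP that by blast
    have pV: "p v \<in> V" if "v \<in> V" for v
      using pP[OF that] part by (auto simp: partition_on_def)
    have pp: "p (p v) = v" if "v \<in> V" for v
      using p_eq[OF pV[OF that]] pP[OF that] by (simp add: insert_commute)
    have "p permutes V"
      by (rule bij_imp_permutes, rule bij_betw_byWitness[where f' = p])
        (auto simp: pp pV, simp add: p_def)
    moreover have "p v = v \<or> E v (p v)" if v: "v \<in> V" for v
    proof (cases "p v = v")
      case False
      then have "card {v, p v} = 2" by simp
      then obtain a b where "{v, p v} = {a, b}" "E a b" "E b a" using P pP[OF v] by blast
      then show ?thesis by (auto simp: doubleton_eq_iff)
    qed simp
    ultimately have "p \<in> ?I" using pp by blast
    moreover have "?h p = P"
    proof (intro equalityI subsetI)
      fix T assume T: "T \<in> P"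
      then have "T \<noteq> {}" "T \<subseteq> V" using part by (auto simp: partition_on_def)
      then obtain v where v: "v \<in> T" "v \<in> V" by blast
      have "T = {v, p v}"
        using block_eq[OF T pP[OF v(2)] v(1)] by blast
      then show "T \<in> ?h p" using v by blast
    next
      fix T assume "T \<in> ?h p"
      then show "T \<in> P" using pP by blast
    qed
    ultimately show "P \<in> ?h ` ?I" by blast
  qed
qed

section \<open>The game\<close>

text \<open>The set of six offsets is closed under negation. Since both buttons have positive
  coordinates, the truncated subtractions can be rewritten as additions in
  \<open>adj\<close>.\<close>

lemma neighbors_sym:
  assumes "a \<in> buttons n" "b \<in> neighbors n a"
  shows "a \<in> neighbors n b"
proof -
  obtain r s where a: "a = (r, s)" by fastforce
  obtain t u where b: "b = (t, u)" by fastforce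
  have pos: "1 \<le> s" "s \<le> r" "1 \<le> u" "u \<le> t"
    and adj: "t = r \<and> s = u + 1 \<or> t = r \<and> u = s + 1 \<or> r = t + 1 \<and> s = u + 1 \<or>
      r = t + 1 \<and> s = u \<or> t = r + 1 \<and> u = s \<or> t = r + 1 \<and> u = s + 1"
    using assms by (auto simp: a b neighbors_def buttons_def)
  from adj have "a \<in> {(t, u - 1), (t, u + 1), (t - 1, u - 1), (t - 1, u), (t + 1, u), (t + 1, u + 1)}"
    by (elim disjE) (simp_all add: a)
  then show ?thesis using assms(1) by (simp add: b neighbors_def)
qed

text \<open>The relation of the matrix \<open>A\<close> from the overview, oriented as in
  \<open>toggled\<close>: \<open>x\<close> is pressed and \<open>v\<close> changes state.\<close>

definition affects :: "nat \<Rightarrow> button \<Rightarrow> button \<Rightarrow> bool" where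
  "affects n v x \<longleftrightarrow> v = x \<or> v \<in> neighbors n x"

lemma press_eq_sym_diff_toggled:
  assumes "x \<in> buttons n"
  shows "press n x C = sym_diff C (toggled (buttons n) (affects n) {x})"
proof -
  have "{y. y = x \<and> affects n v y} = (if affects n v x then {x} else {})" for v by auto
  then have "toggled (buttons n) (affects n) {x} = insert x (neighbors n x)"
    using assms by (auto simp: toggled_def affects_def neighbors_def)
  then show ?thesis by (simp add: press_def)
qed

text \<open>Each press adds one column of the matrix. In the induction step \<open>x\<close> is new,
  so \<open>insert x X\<close> is \<open>sym_diff X {x}\<close> and additivity of
  \<open>toggled\<close> applies.\<close>

lemma fold_press:
  assumes "X \<subseteq> buttons n"
  shows "Finite_Set.fold (press n) C X = sym_diff C (toggled (buttons n) (affects n) X)"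
proof -
  interpret comp_fun_commute "press n" by (rule comp_fun_commute_press)
  have "finite X" using assms finite_buttons by (rule finite_subset)
  then show ?thesis using assms
  proof (induction X)
    case empty
    then show ?case by (simp add: toggled_def)
  next
    case (insert x X)
    have "toggled (buttons n) (affects n) (insert x X) =
        sym_diff (toggled (buttons n) (affects n) X) (toggled (buttons n) (affects n) {x})"
      using toggled_sym_diff[of X "{x}" "buttons n" "affects n"] insert.hyps by simp
    then show ?case using insert by (auto simp: press_eq_sym_diff_toggled)
  qed
qed

text \<open>A symmetric difference is empty only for equal sets. Solvability of every configuration
  thus becomes surjectivity of \<open>toggled\<close>.\<close>

lemma is_solution_iff_toggled:
  "is_solution n C X \<longleftrightarrow> X \<subseteq> buttons n \<and> toggled (buttons n) (affects n) X = C"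
  by (auto simp: is_solution_def moves_to_def fold_press)

text \<open>Blocks of a partition lie inside the board, where adjacency is symmetric. This gives
  coverings the two-sided form used in \<open>bij_betw_involutions_partitions\<close>.\<close>

lemma coverings_eq:
  "coverings n = {P. partition_on (buttons n) P \<and> (\<forall>T\<in>P. (card T = 1 \<or> card T = 2) \<and>
     (card T = 2 \<longrightarrow> (\<exists>a b. T = {a, b} \<and> a \<in> neighbors n b \<and> b \<in> neighbors n a)))}"
proof -
  have "a \<in> neighbors n b \<longleftrightarrow> b \<in> neighbors n a"
    if "partition_on (buttons n) P" "{a, b} \<in> P" for P a b
  proof -
    have "a \<in> buttons n" "b \<in> buttons n" using that by (auto simp: partition_on_def)
    then show ?thesis using neighbors_sym by blast
  qed
  then show ?thesis unfolding coverings_def by blast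
qed

theorem theorem3:
  fixes n :: nat
  assumes "n \<ge> 1"
  shows "(\<forall>C. C \<subseteq> buttons n \<longrightarrow> (\<exists>X. is_solution n C X)) \<longleftrightarrow> odd (card (coverings n))"
proof -
  let ?V = "buttons n"
  have "(\<forall>C. C \<subseteq> ?V \<longrightarrow> (\<exists>X. is_solution n C X)) \<longleftrightarrow>
      odd (card {p. p permutes ?V \<and> (\<forall>v\<in>?V. affects n v (p v))})"
    unfolding is_solution_iff_toggled by (rule toggled_surj_iff_odd_permutations[OF finite_buttons])
  also have "\<dots> \<longleftrightarrow> odd (card {p. p permutes ?V \<and> (\<forall>v\<in>?V. affects n v (p v)) \<and>
      (\<forall>v\<in>?V. p (p v) = v)})"
    by (rule odd_permutations_iff_odd_involutions[OF finite_buttons])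
      (auto simp: affects_def neighbors_sym)
  also have "card {p. p permutes ?V \<and> (\<forall>v\<in>?V. affects n v (p v)) \<and> (\<forall>v\<in>?V. p (p v) = v)} =
      card (coverings n)"
    \<comment> \<open>With \<open>E a b\<close> taken as \<open>a \<in> neighbors n b\<close>, the
      condition \<open>affects n v (p v)\<close> is \<open>p v = v \<or> E v (p v)\<close> up to the
      direction of the equation.\<close>
    using bij_betw_same_card[OF bij_betw_involutions_partitions[of ?V "\<lambda>a b. a \<in> neighbors n b"]]
      neighbors_sym unfolding coverings_eq affects_def by (simp add: eq_commute)
  finally show ?thesis .
qed

end
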